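(* Let $\alpha>0$, let $\nu$ be a symmetric probability measure on $\mathbb{R}$, and let $\{X_n: n\in\mathbb{N}_0\}$ be the Kendall random walk with parameter $\alpha$ and step distribution $\nu$. Let $\tau_0^+=\min\{n\geqslant1: X_n>0\}$ and $\tau_0^-=\min\{n\geqslant1:X_n<0\}$. Then the random variable $\tau_0^+$ (and, by symmetry of the Kendall random walk, also the variable $\tau_0^-$) has the geometric distribution $$\mathbf{P}(\tau_0^+=k)=\frac{1}{2^k},\quad k=1,2,\dots,$$ and it has the following moments generating function: $$\mathbf{E}\,s^{\tau_0^+}=\frac{\frac s2}{1-\frac s2},\quad 0\leqslant s<2.$$
   Context: Fix $\alpha>0$. For $a\neq0$, $(T_a\lambda)(A)=\lambda(A/a)$ for Borel sets $A$, and $T_0\lambda=\delta_0$. Put $\widetilde{\delta}_x=\frac12\delta_x+\frac12\delta_{-x}$ and let $\widetilde{\pi}_{2\alpha}(dy)=\alpha|y|^{-2\alpha-1}\mathbf{1}_{[1,\infty)}(|y|)\,dy$ (symmetric Pareto distribution). Kendall convolution: for $x,y\in\mathbb{R}$ let $M=\max\{|x|,|y|\}$, $m=\min\{|x|,|y|\}$, $\varrho=m/M$, and $$\delta_x\vartriangle_\alpha\delta_y=\widetilde{\delta}_x\vartriangle_\alpha\widetilde{\delta}_y:=T_M\left(\varrho^\alpha\widetilde{\pi}_{2\alpha}+(1-\varrho^\alpha)\widetilde{\delta}_1\right)$$ (equal to $\delta_0$ if $x=y=0$, by the convention for $T_0$); for probability measures, $(\nu_1\vartriangle_\alpha\nu_2)(A)=\int_{\mathbb{R}^2}(\delta_x\vartriangle_\alpha\delta_y)(A)\,\nu_1(dx)\nu_2(dy)$.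 $\nu^{\vartriangle_\alpha n}$ denotes the $n$-fold Kendall convolution of $\nu$. The Kendall random walk with step distribution $\nu$ (a symmetric probability measure on $\mathbb{R}$) is the Markov process $\{X_n:n\in\mathbb{N}_0\}$ with $X_0\equiv0$ and transition probabilities $P_n(x,A)=\mathbf{P}\{X_{n+k}\in A\mid X_k=x\}=(\delta_x\vartriangle_\alpha\nu^{\vartriangle_\alpha n})(A)$; in particular $X_1\sim\nu$. The convention is $\min\emptyset=\infty$.
   Formalization: The step distribution ν is additionally assumed to have no atom at 0, i.e. ν({0}) = 0; without this the claim fails, since P(τ₀⁺ = 1) = (1 − ν({0}))/2 (e.g. for ν = δ₀ the walk never leaves 0). *)

theory Defs
  imports "HOL-Probability.Probability" "HOL-Library.Extended_Nat"
begin

section \<open>The Kendall convolution\<close>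

definition dilation :: "real \<Rightarrow> real measure \<Rightarrow> real measure" where
  "dilation a \<mu> = (if a = 0 then return borel 0 else distr \<mu> borel (\<lambda>x. a * x))"

definition mixture :: "real \<Rightarrow> real measure \<Rightarrow> real measure \<Rightarrow> real measure" where
  "mixture p \<mu> \<nu> = measure_of UNIV (sets borel)
     (\<lambda>A. ennreal p * emeasure \<mu> A + ennreal (1 - p) * emeasure \<nu> A)"

definition sym_dirac :: "real \<Rightarrow> real measure" where
  "sym_dirac x = mixture (1 / 2) (return borel x) (return borel (- x))"

text \<open>The symmetric Pareto distribution with index \<open>2 * \<alpha>\<close>; the parameter is \<open>\<alpha>\<close>.\<close>

definition sym_pareto :: "real \<Rightarrow> real measure" where
  "sym_pareto \<alpha> = density lborel
     (\<lambda>y. ennreal (\<alpha> * \<bar>y\<bar> powr (- 2 * \<alpha> - 1) * indicator {1..} \<bar>y\<bar>))"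

text \<open>For \<open>x = y = 0\<close> the quotient is \<open>0 / 0 = 0\<close>, but its value is irrelevant, as
  \<open>dilation 0\<close> is constantly the Dirac measure at 0.\<close>

definition kendall_dirac :: "real \<Rightarrow> real \<Rightarrow> real \<Rightarrow> real measure" where
  "kendall_dirac \<alpha> x y =
     (let M = max \<bar>x\<bar> \<bar>y\<bar>; r = min \<bar>x\<bar> \<bar>y\<bar> / M
      in dilation M (mixture (r powr \<alpha>) (sym_pareto \<alpha>) (sym_dirac 1)))"

text \<open>Via the Giry monad; lemma \<open>emeasure_kendall_conv\<close> below gives the integral formula.\<close>

definition kendall_conv :: "real \<Rightarrow> real measure \<Rightarrow> real measure \<Rightarrow> real measure" where
  "kendall_conv \<alpha> \<nu>1 \<nu>2 = (\<nu>1 \<Otimes>\<^sub>M \<nu>2) \<bind> (\<lambda>(x, y). kendall_dirac \<alpha> x y)"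

text \<open>The \<open>n\<close>-fold convolution power, meaningful for \<open>n \<ge> 1\<close>; the first power is \<open>\<nu>\<close> itself.\<close>

definition kendall_power :: "real \<Rightarrow> real measure \<Rightarrow> nat \<Rightarrow> real measure" where
  "kendall_power \<alpha> \<nu> n = ((\<lambda>\<mu>. kendall_conv \<alpha> \<mu> \<nu>) ^^ (n - 1)) \<nu>"

section \<open>Kendall random walks\<close>

definition symmetric_distribution :: "real measure \<Rightarrow> bool" where
  "symmetric_distribution \<nu> \<longleftrightarrow>
     prob_space \<nu> \<and> sets \<nu> = sets borel \<and> distr \<nu> borel uminus = \<nu>"

definition kendall_transition :: "real \<Rightarrow> real measure \<Rightarrow> nat \<Rightarrow> real \<Rightarrow> real measure" where
  "kendall_transition \<alpha> \<nu> n x = kendall_conv \<alpha> (return borel x) (kendall_power \<alpha> \<nu> n)"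

definition past :: "'a measure \<Rightarrow> (nat \<Rightarrow> 'a \<Rightarrow> real) \<Rightarrow> nat \<Rightarrow> 'a measure" where
  "past M X k = sigma (space M) {X i -` A \<inter> space M | i A. i \<le> k \<and> A \<in> sets borel}"

text \<open>
  The \<open>n\<close>-step transition law is required for \<open>n \<ge> 1\<close> only: convolving with the Dirac measure at 0
  symmetrises, so it is not the identity and the formula for \<open>n = 0\<close> would fail.
\<close>

locale kendall_random_walk = prob_space M
  for M :: "'a measure" and \<alpha> :: real and \<nu> :: "real measure" and X :: "nat \<Rightarrow> 'a \<Rightarrow> real" +
  assumes random_variable_X: "\<And>n. X n \<in> borel_measurable M"
    and X_0: "\<And>\<omega>. \<omega> \<in> space M \<Longrightarrow> X 0 \<omega> = 0"
    and markov_transition: "\<And>k n A. n \<ge> 1 \<Longrightarrow> A \<in> sets borel \<Longrightarrow>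
      AE \<omega> in M. real_cond_exp M (past M X k) (\<lambda>\<omega>. indicator A (X (n + k) \<omega>)) \<omega>
        = measure (kendall_transition \<alpha> \<nu> n (X k \<omega>)) A"

text \<open>First entrance times after time 0; in \<^typ>\<open>enat\<close> the infimum of the empty set is \<open>\<infinity>\<close>.\<close>

definition first_positive :: "(nat \<Rightarrow> 'a \<Rightarrow> real) \<Rightarrow> 'a \<Rightarrow> enat" where
  "first_positive X \<omega> = Inf {enat n | n. n \<ge> 1 \<and> X n \<omega> > 0}"

definition first_negative :: "(nat \<Rightarrow> 'a \<Rightarrow> real) \<Rightarrow> 'a \<Rightarrow> enat" where
  "first_negative X \<omega> = Inf {enat n | n. n \<ge> 1 \<and> X n \<omega> < 0}"

text \<open>\<open>s\<^sup>t\<close> for \<open>s \<ge> 0\<close>, with \<open>s\<^sup>\<infinity>\<close> the limit of \<open>s\<^sup>n\<close>.\<close>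

definition enat_power :: "real \<Rightarrow> enat \<Rightarrow> ennreal" where
  "enat_power s t = (case t of enat n \<Rightarrow> ennreal (s ^ n)
     | \<infinity> \<Rightarrow> (if s < 1 then 0 else if s = 1 then 1 else \<infinity>))"

section \<open>Basic facts\<close>

lemma
  shows space_mixture [simp]: "space (mixture p \<mu> \<nu>) = UNIV"
    and sets_mixture [simp, measurable_cong]: "sets (mixture p \<mu> \<nu>) = sets borel"
  using sets.space_closed[of borel] sets.sigma_sets_eq[of "borel :: real measure"]
  by (auto simp: mixture_def)

lemma emeasure_mixture:
  assumes [simp]: "sets \<mu> = sets borel" "sets \<nu> = sets borel" and A: "A \<in> sets borel"
  shows "emeasure (mixture p \<mu> \<nu>) A
    = ennreal p * emeasure \<mu> A + ennreal (1 - p) * emeasure \<nu> A"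
  unfolding mixture_def
proof (rule emeasure_measure_of_sigma)
  show "sigma_algebra UNIV (sets (borel :: real measure))"
    using sets.sigma_algebra_axioms[of "borel :: real measure"] by simp
  show "positive (sets borel) (\<lambda>A. ennreal p * emeasure \<mu> A + ennreal (1 - p) * emeasure \<nu> A)"
    by (simp add: positive_def)
  show "countably_additive (sets borel)
      (\<lambda>A. ennreal p * emeasure \<mu> A + ennreal (1 - p) * emeasure \<nu> A)"
  proof (rule countably_additiveI)
    fix F :: "nat \<Rightarrow> real set"
    assume F: "range F \<subseteq> sets borel" "disjoint_family F"
    have "(\<Sum>i. ennreal p * emeasure \<mu> (F i) + ennreal (1 - p) * emeasure \<nu> (F i))
      = ennreal p * (\<Sum>i. emeasure \<mu> (F i)) + ennreal (1 - p) * (\<Sum>i. emeasure \<nu> (F i))"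
      by (simp add: suminf_add[symmetric])
    also have "(\<Sum>i. emeasure \<mu> (F i)) = emeasure \<mu> (\<Union>i. F i)"
      using F by (intro suminf_emeasure) auto
    also have "(\<Sum>i. emeasure \<nu> (F i)) = emeasure \<nu> (\<Union>i. F i)"
      using F by (intro suminf_emeasure) auto
    finally show "(\<Sum>i. ennreal p * emeasure \<mu> (F i) + ennreal (1 - p) * emeasure \<nu> (F i))
      = ennreal p * emeasure \<mu> (\<Union>i. F i) + ennreal (1 - p) * emeasure \<nu> (\<Union>i. F i)" .
  qed
qed (use A in auto)

lemma prob_space_mixture:
  assumes "prob_space \<mu>" "prob_space \<nu>" "sets \<mu> = sets borel" "sets \<nu> = sets borel"
    and "0 \<le> p" "p \<le> 1"
  shows "prob_space (mixture p \<mu> \<nu>)"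
proof
  have "space \<mu> = UNIV" "space \<nu> = UNIV"
    using assms(3,4)[THEN sets_eq_imp_space_eq] by simp_all
  with assms(1,2) have "emeasure \<mu> UNIV = 1" "emeasure \<nu> UNIV = 1"
    by (metis prob_space.emeasure_space_1)+
  with assms(3-) show "emeasure (mixture p \<mu> \<nu>) (space (mixture p \<mu> \<nu>)) = 1"
    by (simp add: emeasure_mixture flip: ennreal_plus)
qed

lemma sets_sym_dirac [simp, measurable_cong]: "sets (sym_dirac x) = sets borel"
  by (simp add: sym_dirac_def)

lemma prob_space_sym_dirac: "prob_space (sym_dirac x)"
  unfolding sym_dirac_def by (rule prob_space_mixture) (auto intro: prob_space_return)

lemma sets_sym_pareto [simp, measurable_cong]: "sets (sym_pareto \<alpha>) = sets borel"
  by (simp add: sym_pareto_def)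

lemma emeasure_sym_pareto:
  assumes [measurable]: "A \<in> sets borel"
  shows "emeasure (sym_pareto \<alpha>) A = (\<integral>\<^sup>+y.
    ennreal (\<alpha> * \<bar>y\<bar> powr (- 2 * \<alpha> - 1) * indicator {1..} \<bar>y\<bar>) * indicator A y \<partial>lborel)"
  unfolding sym_pareto_def by (rule emeasure_density) measurable

lemma prob_space_sym_pareto:
  assumes "\<alpha> > 0"
  shows "prob_space (sym_pareto \<alpha>)"
proof
  define f where
    "f = (\<lambda>y::real. ennreal (\<alpha> * \<bar>y\<bar> powr (- 2 * \<alpha> - 1) * indicator {1..} \<bar>y\<bar>))"
  have [measurable]: "f \<in> borel_measurable borel"
    unfolding f_def by measurable
  have pos: "(\<integral>\<^sup>+y. f y * indicator {0..} y \<partial>lborel) = ennreal (1 / 2)"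
  proof -
    have "(\<integral>\<^sup>+y. f y * indicator {0..} y \<partial>lborel)
      = (\<integral>\<^sup>+y. ennreal (\<alpha> * y powr (- 2 * \<alpha> - 1)) * indicator {1..} y \<partial>lborel)"
      by (intro nn_integral_cong) (auto simp: f_def indicator_def)
    also have "\<dots> = ennreal (0 - (- (1 / 2) * 1 powr (- 2 * \<alpha>)))"
    proof (rule nn_integral_FTC_atLeast[where F = "\<lambda>y. - (1 / 2) * y powr (- 2 * \<alpha>)"])
      fix y :: real assume y: "1 \<le> y"
      show "((\<lambda>y. - (1 / 2) * y powr (- 2 * \<alpha>)) has_real_derivative
          \<alpha> * y powr (- 2 * \<alpha> - 1)) (at y)"
        using y by (auto intro!: derivative_eq_intros)
      show "0 \<le> \<alpha> * y powr (- 2 * \<alpha> - 1)"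
        using assms by simp
    next
      have "((\<lambda>y. y powr (- 2 * \<alpha>)) \<longlongrightarrow> 0) at_top"
        using assms by (intro tendsto_neg_powr filterlim_ident) simp
      from tendsto_mult_right[OF this, of "- (1 / 2)"]
      show "((\<lambda>y. - (1 / 2) * y powr (- 2 * \<alpha>)) \<longlongrightarrow> 0) at_top" by simp
    qed auto
    finally show ?thesis by simp
  qed
  have neg: "(\<integral>\<^sup>+y. f y * indicator {..<0} y \<partial>lborel) = ennreal (1 / 2)"
  proof -
    have "(\<integral>\<^sup>+y. f y * indicator {..<0} y \<partial>lborel)
      = (\<integral>\<^sup>+y. f (- y) * indicator {..<0} (- y) \<partial>lborel)"
      using nn_integral_real_affine[of "\<lambda>y. f y * indicator {..<0} y" "-1" 0] by simp
    also have "\<dots> = (\<integral>\<^sup>+y. f y * indicator {0..} y \<partial>lborel)"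
      by (intro nn_integral_cong) (auto simp: f_def indicator_def)
    finally show ?thesis using pos by simp
  qed
  have "emeasure (sym_pareto \<alpha>) UNIV
    = (\<integral>\<^sup>+y. f y * indicator {0..} y + f y * indicator {..<0} y \<partial>lborel)"
    by (subst emeasure_sym_pareto) (auto simp: f_def indicator_def intro!: nn_integral_cong)
  also have "\<dots> = ennreal (1 / 2) + ennreal (1 / 2)"
    by (subst nn_integral_add) (simp_all only: pos neg, measurable)
  also have "\<dots> = (1::ennreal)"
    by (subst ennreal_plus[symmetric]) auto
  finally show "emeasure (sym_pareto \<alpha>) (space (sym_pareto \<alpha>)) = 1"
    by (simp add: sym_pareto_def)
qed

lemma sets_kendall_dirac [simp, measurable_cong]: "sets (kendall_dirac \<alpha> x y) = sets borel"
  by (simp add: kendall_dirac_def dilation_def Let_def)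

lemma prob_space_kendall_dirac:
  assumes "\<alpha> > 0"
  shows "prob_space (kendall_dirac \<alpha> x y)"
proof -
  let ?r = "min \<bar>x\<bar> \<bar>y\<bar> / max \<bar>x\<bar> \<bar>y\<bar>"
  have r: "0 \<le> ?r" "?r \<le> 1"
    by (auto simp: divide_le_eq_1)
  have "?r powr \<alpha> \<le> 1 powr \<alpha>"
    using r assms by (intro powr_mono2) auto
  then have "prob_space (mixture (?r powr \<alpha>) (sym_pareto \<alpha>) (sym_dirac 1))"
    by (intro prob_space_mixture prob_space_sym_pareto prob_space_sym_dirac assms) auto
  then show ?thesis
    unfolding kendall_dirac_def dilation_def Let_def
    by (auto intro!: prob_space_return prob_space.prob_space_distr)
qed

lemma emeasure_kendall_dirac:
  fixes \<alpha> x y :: real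
  assumes "x \<noteq> 0 \<or> y \<noteq> 0" and A [measurable]: "A \<in> sets borel"
  defines "m \<equiv> max \<bar>x\<bar> \<bar>y\<bar>" and "p \<equiv> (min \<bar>x\<bar> \<bar>y\<bar> / max \<bar>x\<bar> \<bar>y\<bar>) powr \<alpha>"
  shows "emeasure (kendall_dirac \<alpha> x y) A =
    ennreal p * emeasure (sym_pareto \<alpha>) {z. m * z \<in> A}
    + ennreal (1 - p) * (ennreal (1 / 2) * indicator A m + ennreal (1 / 2) * indicator A (- m))"
proof -
  have m: "m \<noteq> 0" using assms(1) by (auto simp: m_def max_def)
  have S [measurable]: "{z. m * z \<in> A} \<in> sets borel" by measurable
  have "emeasure (kendall_dirac \<alpha> x y) A
    = emeasure (mixture p (sym_pareto \<alpha>) (sym_dirac 1)) {z. m * z \<in> A}"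
    unfolding kendall_dirac_def Let_def dilation_def p_def m_def
    using m by (auto simp: emeasure_distr vimage_def m_def)
  also have "\<dots> = ennreal p * emeasure (sym_pareto \<alpha>) {z. m * z \<in> A}
    + ennreal (1 - p) * emeasure (sym_dirac 1) {z. m * z \<in> A}"
    by (rule emeasure_mixture) auto
  also have "emeasure (sym_dirac 1) {z. m * z \<in> A}
    = ennreal (1 / 2) * indicator A m + ennreal (1 / 2) * indicator A (- m)"
    unfolding sym_dirac_def by (subst emeasure_mixture) (auto simp: indicator_def)
  finally show ?thesis .
qed

lemma measurable_kendall_dirac:
  assumes "\<alpha> > 0"
  shows "(\<lambda>(x, y). kendall_dirac \<alpha> x y) \<in> borel \<Otimes>\<^sub>M borel \<rightarrow>\<^sub>M prob_algebra borel"
proof (rule measurable_prob_algebraI)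
  show "prob_space ((\<lambda>(x, y). kendall_dirac \<alpha> x y) z)" for z
    using prob_space_kendall_dirac[OF assms] by (simp split: prod.split)
  show "(\<lambda>(x, y). kendall_dirac \<alpha> x y) \<in> borel \<Otimes>\<^sub>M borel \<rightarrow>\<^sub>M subprob_algebra borel"
  proof (rule measurable_subprob_algebra)
    show "subprob_space ((\<lambda>(x, y). kendall_dirac \<alpha> x y) z)" for z
      using prob_space_kendall_dirac[OF assms]
      by (auto split: prod.split intro: prob_space_imp_subprob_space)
    show "sets ((\<lambda>(x, y). kendall_dirac \<alpha> x y) z) = sets borel" for z
      by (simp split: prod.split)
    fix A :: "real set" assume A [measurable]: "A \<in> sets borel"
    have eq: "(\<lambda>z. emeasure ((\<lambda>(x, y). kendall_dirac \<alpha> x y) z) A) = (\<lambda>(x, y).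
      if x = 0 \<and> y = 0 then indicator A 0 else
      let m = max \<bar>x\<bar> \<bar>y\<bar>; p = (min \<bar>x\<bar> \<bar>y\<bar> / max \<bar>x\<bar> \<bar>y\<bar>) powr \<alpha> in
      ennreal p * (\<integral>\<^sup>+w. ennreal (\<alpha> * \<bar>w\<bar> powr (- 2 * \<alpha> - 1) * indicator {1..} \<bar>w\<bar>)
        * indicator A (m * w) \<partial>lborel)
      + ennreal (1 - p) * (ennreal (1 / 2) * indicator A m + ennreal (1 / 2) * indicator A (- m)))"
      (is "_ = ?f")
    proof (intro ext, clarify, goal_cases)
      case (1 x y)
      have *: "emeasure (sym_pareto \<alpha>) {z. max \<bar>x\<bar> \<bar>y\<bar> * z \<in> A} =
        (\<integral>\<^sup>+w. ennreal (\<alpha> * \<bar>w\<bar> powr (- 2 * \<alpha> - 1) * indicator {1..} \<bar>w\<bar>)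
          * indicator A (max \<bar>x\<bar> \<bar>y\<bar> * w) \<partial>lborel)"
        by (subst emeasure_sym_pareto) (auto simp: indicator_def intro!: nn_integral_cong)
      show ?case
      proof (cases "x = 0 \<and> y = 0")
        case True
        then show ?thesis by (simp add: kendall_dirac_def dilation_def)
      next
        case False
        then have "x \<noteq> 0 \<or> y \<noteq> 0" by simp
        from emeasure_kendall_dirac[OF this A] show ?thesis
          by (simp only: * Let_def prod.case if_not_P[OF False])
      qed
    qed
    show "(\<lambda>z. emeasure ((\<lambda>(x, y). kendall_dirac \<alpha> x y) z) A)
      \<in> borel_measurable (borel \<Otimes>\<^sub>M borel)"
      unfolding eq Let_def by measurable
  qed
qed

lemma emeasure_kendall_conv:
  assumes "\<alpha> > 0" "prob_space \<nu>1" "prob_space \<nu>2"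
    and [simp, measurable_cong]: "sets \<nu>1 = sets borel" "sets \<nu>2 = sets borel"
    and A: "A \<in> sets borel"
  shows "emeasure (kendall_conv \<alpha> \<nu>1 \<nu>2) A =
    (\<integral>\<^sup>+(x, y). emeasure (kendall_dirac \<alpha> x y) A \<partial>(\<nu>1 \<Otimes>\<^sub>M \<nu>2))"
proof -
  interpret \<nu>1: prob_space \<nu>1 by fact
  interpret \<nu>2: prob_space \<nu>2 by fact
  interpret pair_prob_space \<nu>1 \<nu>2 ..
  have s: "sets (\<nu>1 \<Otimes>\<^sub>M \<nu>2) = sets (borel \<Otimes>\<^sub>M borel)"
    by (rule sets_pair_measure_cong) auto
  have "\<nu>1 \<Otimes>\<^sub>M \<nu>2 \<in> space (prob_algebra (\<nu>1 \<Otimes>\<^sub>M \<nu>2))"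
    by (simp add: space_prob_algebra prob_space_axioms)
  moreover have "(\<lambda>(x, y). kendall_dirac \<alpha> x y) \<in> \<nu>1 \<Otimes>\<^sub>M \<nu>2 \<rightarrow>\<^sub>M prob_algebra borel"
    using measurable_kendall_dirac[OF assms(1)] measurable_cong_sets[OF s refl] by blast
  ultimately show ?thesis
    unfolding kendall_conv_def using A
    by (subst emeasure_bind_prob_algebra) (auto intro!: nn_integral_cong)
qed

end

theory Submission
  imports Defs
begin

text \<open>
  Since \<open>\<nu>\<close> has no atom at 0, every one-step transition law gives mass \<open>1 / 2\<close> to each open
  half-line, irrespective of the current state. Hence, conditionally on the past, each step enters
  a given half-line with probability \<open>1 / 2\<close>, so the first entrance is the first success in a
  sequence of fair coin tosses.
\<close>

section \<open>Half-line masses of the one-step transition law\<close>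

text \<open>The density is even, so reflection equates the two half-lines; the origin has mass 0 and
  the total mass is 1.\<close>

lemma emeasure_sym_pareto_half_line:
  assumes "\<alpha> > 0"
  shows "emeasure (sym_pareto \<alpha>) {0<..} = ennreal (1 / 2)"
    and "emeasure (sym_pareto \<alpha>) {..<0} = ennreal (1 / 2)"
proof -
  interpret prob_space "sym_pareto \<alpha>"
    using assms by (rule prob_space_sym_pareto)
  define f where
    "f = (\<lambda>y::real. ennreal (\<alpha> * \<bar>y\<bar> powr (- 2 * \<alpha> - 1) * indicator {1..} \<bar>y\<bar>))"
  have [measurable]: "f \<in> borel_measurable borel"
    unfolding f_def by measurable
  have f: "emeasure (sym_pareto \<alpha>) A = (\<integral>\<^sup>+y. f y * indicator A y \<partial>lborel)"
    if "A \<in> sets borel" for A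
    using emeasure_sym_pareto[OF that] by (simp add: f_def)
  have "(\<integral>\<^sup>+y. f y * indicator {..<0} y \<partial>lborel)
      = (\<integral>\<^sup>+y. f (- y) * indicator {..<0} (- y) \<partial>lborel)"
    using nn_integral_real_affine[of "\<lambda>y. f y * indicator {..<0} y" "-1" 0] by simp
  also have "\<dots> = (\<integral>\<^sup>+y. f y * indicator {0<..} y \<partial>lborel)"
    by (intro nn_integral_cong) (auto simp: f_def indicator_def)
  finally have "emeasure (sym_pareto \<alpha>) {..<0} = emeasure (sym_pareto \<alpha>) {0<..}"
    by (simp add: f)
  then have eq: "prob {..<0} = prob {0<..}"
    by (simp add: measure_def)
  \<comment> \<open>The density itself vanishes at 0, so the integrand is identically zero.\<close>
  have "(\<lambda>y. f y * indicator {0} y) = (\<lambda>_. 0)"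
    by (auto simp: f_def split: split_indicator)
  then have "emeasure (sym_pareto \<alpha>) {0} = 0"
    by (simp add: f del: mult_eq_0_iff)
  then have "prob {0} = 0"
    by (simp add: measure_def)
  moreover have "prob ({0<..} \<union> ({0} \<union> {..<0})) = prob {0<..} + (prob {0} + prob {..<0})"
    by (subst finite_measure_Union; (subst finite_measure_Union)?) auto
  moreover have "{0<..} \<union> ({0} \<union> {..<0}) = space (sym_pareto \<alpha>)"
    by (auto simp: sym_pareto_def)
  ultimately have "prob {0<..} = 1 / 2" "prob {..<0} = 1 / 2"
    using eq prob_space by simp_all
  then show "emeasure (sym_pareto \<alpha>) {0<..} = ennreal (1 / 2)"
    "emeasure (sym_pareto \<alpha>) {..<0} = ennreal (1 / 2)"
    by (simp_all only: emeasure_eq_measure)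
qed

text \<open>Dilation by a positive factor preserves an open half-line, and both components of the
  mixture give it mass 1/2, so the weight cancels. The condition \<open>y \<noteq> 0\<close>
  excludes the degenerate law \<open>return borel 0\<close>.\<close>

lemma emeasure_kendall_dirac_half_line:
  assumes "\<alpha> > 0" "y \<noteq> 0" and A: "A \<in> {{0<..}, {..<0}}"
  shows "emeasure (kendall_dirac \<alpha> x y) A = ennreal (1 / 2)"
proof -
  define m where "m = max \<bar>x\<bar> \<bar>y\<bar>"
  define r where "r = min \<bar>x\<bar> \<bar>y\<bar> / m"
  have m: "m > 0"
    using assms by (auto simp: m_def)
  \<comment> \<open>These bounds make both mixture weights nonnegative, which lets sums and products
    pass through \<open>ennreal\<close> below.\<close>
  have "0 \<le> r" "r \<le> 1"
    using m by (auto simp: r_def m_def divide_le_eq_1)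
  then have p: "0 \<le> r powr \<alpha>" "r powr \<alpha> \<le> 1"
    using assms powr_mono2[of \<alpha> r 1] by auto
  have "{z. m * z \<in> A} = A"
    using A m by (auto simp: zero_less_mult_iff mult_less_0_iff)
  then have pareto: "emeasure (sym_pareto \<alpha>) {z. m * z \<in> A} = ennreal (1 / 2)"
    using A emeasure_sym_pareto_half_line[OF assms(1)] by auto
  have dirac: "ennreal (1 / 2) * indicator A m + ennreal (1 / 2) * indicator A (- m)
      = ennreal (1 / 2)"
    using A m by auto
  have "emeasure (kendall_dirac \<alpha> x y) A = ennreal (r powr \<alpha>) * ennreal (1 / 2)
      + ennreal (1 - r powr \<alpha>) * ennreal (1 / 2)"
    using assms emeasure_kendall_dirac[of x y A \<alpha>, folded m_def, folded r_def]
    unfolding pareto dirac by auto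
  also have "\<dots> = ennreal (r powr \<alpha> * (1 / 2) + (1 - r powr \<alpha>) * (1 / 2))"
    using p by (subst ennreal_plus) (simp_all only: ennreal_mult, auto)
  also have "r powr \<alpha> * (1 / 2) + (1 - r powr \<alpha>) * (1 / 2) = 1 / 2"
    by (simp add: field_simps)
  finally show ?thesis .
qed

text \<open>Without an atom at 0, almost every step is nonzero, so the integrand in the convolution
  formula is almost everywhere the constant 1/2, whatever the state \<open>x\<close>.\<close>

lemma measure_kendall_transition_half_line:
  assumes "\<alpha> > 0" "prob_space \<nu>" and sets [simp, measurable_cong]: "sets \<nu> = sets borel"
    and atom: "measure \<nu> {0} = 0" and A: "A \<in> {{0<..}, {..<0}}"
  shows "measure (kendall_transition \<alpha> \<nu> 1 x) A = 1 / 2"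
proof -
  interpret \<nu>: prob_space \<nu> by fact
  interpret x: prob_space "return borel x" by (rule prob_space_return) simp
  interpret pair_prob_space "return borel x" \<nu> ..
  have [measurable]: "A \<in> sets borel"
    using A by auto
  have "AE y in \<nu>. y \<noteq> 0"
    using atom by (intro AE_I[of _ _ "{0}"]) (auto simp: \<nu>.emeasure_eq_measure)
  \<comment> \<open>Measurability of this event is what lifts the almost sure statement from \<nu>
    to the product.\<close>
  moreover have "snd -` (- {0}) \<inter> space (return borel x \<Otimes>\<^sub>M \<nu>)
      \<in> sets (return borel x \<Otimes>\<^sub>M \<nu>)"
    by (rule measurable_sets[OF measurable_snd]) simp
  ultimately have "AE z in return borel x \<Otimes>\<^sub>M \<nu>. snd z \<noteq> 0"
    by (intro AE_pair_measure) (auto simp: vimage_def Int_def conj_commute)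
  then have "(\<integral>\<^sup>+(x, y). emeasure (kendall_dirac \<alpha> x y) A \<partial>(return borel x \<Otimes>\<^sub>M \<nu>))
      = (\<integral>\<^sup>+_. ennreal (1 / 2) \<partial>(return borel x \<Otimes>\<^sub>M \<nu>))"
    by (intro nn_integral_cong_AE)
      (auto elim!: eventually_mono simp: emeasure_kendall_dirac_half_line[OF assms(1) _ A])
  also have "\<dots> = ennreal (1 / 2)"
    by (simp add: emeasure_space_1)
  \<comment> \<open>For n = 1 the iteration count n - 1 in \<open>kendall_power\<close> is 0, which
    leaves \<nu> itself.\<close>
  finally have "emeasure (kendall_transition \<alpha> \<nu> 1 x) A = ennreal (1 / 2)"
    unfolding kendall_transition_def kendall_power_def
    using assms by (simp add: emeasure_kendall_conv x.prob_space_axioms)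
  then show ?thesis
    by (intro measure_eq_emeasure_eq_ennreal) auto
qed

section \<open>First entrance times and the past of the walk\<close>

text \<open>A common form of \<open>first_positive\<close> and \<open>first_negative\<close>, so
  that one argument serves both.\<close>

definition first_entrance :: "real set \<Rightarrow> (nat \<Rightarrow> 'a \<Rightarrow> real) \<Rightarrow> 'a \<Rightarrow> enat" where
  "first_entrance A X \<omega> = Inf {enat n | n. n \<ge> 1 \<and> X n \<omega> \<in> A}"

text \<open>Separates the event into a condition on times up to \<open>k\<close>, which belongs to
  the past, and one on the next step.\<close>

lemma first_entrance_eq_Suc_iff:
  "first_entrance A X \<omega> = enat (Suc k) \<longleftrightarrow> X (Suc k) \<omega> \<in> A \<and> (\<forall>i\<in>{1..k}. X i \<omega> \<notin> A)"
proof
  assume L: "first_entrance A X \<omega> = enat (Suc k)"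
  let ?S = "{enat n | n. n \<ge> 1 \<and> X n \<omega> \<in> A}"
  \<comment> \<open>The infimum of the empty set is \<infinity>, so a finite value forces
    nonemptiness, and then the infimum is attained.\<close>
  have "?S \<noteq> {}"
    using L unfolding first_entrance_def by (metis Inf_empty enat.distinct(1) top_enat_def)
  then have "Inf ?S \<in> ?S"
    unfolding Inf_enat_def by (auto intro: LeastI)
  then have "X (Suc k) \<omega> \<in> A"
    using L by (auto simp: first_entrance_def)
  moreover have "X i \<omega> \<notin> A" if "i \<in> {1..k}" for i
  proof
    assume "X i \<omega> \<in> A"
    with that have "Inf ?S \<le> enat i"
      by (intro Inf_lower) auto
    then show False
      using L that by (simp add: first_entrance_def)
  qed
  ultimately show "X (Suc k) \<omega> \<in> A \<and> (\<forall>i\<in>{1..k}. X i \<omega> \<notin> A)"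
    by blast
next
  assume R: "X (Suc k) \<omega> \<in> A \<and> (\<forall>i\<in>{1..k}. X i \<omega> \<notin> A)"
  show "first_entrance A X \<omega> = enat (Suc k)"
    unfolding first_entrance_def
  proof (rule antisym)
    show "Inf {enat n | n. n \<ge> 1 \<and> X n \<omega> \<in> A} \<le> enat (Suc k)"
      using R by (intro Inf_lower) auto
    show "enat (Suc k) \<le> Inf {enat n | n. n \<ge> 1 \<and> X n \<omega> \<in> A}"
      using R by (intro Inf_greatest) (auto simp: not_less_eq_eq[symmetric])
  qed
qed

lemma sets_past:
  "sets (past M X k)
    = sigma_sets (space M) {X i -` A \<inter> space M | i A. i \<le> k \<and> A \<in> sets borel}"
  unfolding past_def by (rule sets_measure_of) auto

lemma vimage_in_sets_past:
  assumes "i \<le> k" "A \<in> sets borel"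
  shows "X i -` A \<inter> space M \<in> sets (past M X k)"
  unfolding sets_past using assms by (intro sigma_sets.Basic) blast

lemma space_past [simp]: "space (past M X k) = space M"
  unfolding past_def by (rule space_measure_of) auto

lemma subalgebra_past:
  assumes "\<And>n. X n \<in> borel_measurable M"
  shows "subalgebra M (past M X k)"
  unfolding subalgebra_def
proof
  have "{X i -` A \<inter> space M | i A. i \<le> k \<and> A \<in> sets borel} \<subseteq> sets M"
    using assms by (auto intro: measurable_sets)
  then show "sets (past M X k) \<subseteq> sets M"
    unfolding sets_past by (rule sets.sigma_sets_subset)
qed simp

section \<open>Geometric law and generating function\<close>

context prob_space
begin

text \<open>A constant conditional hitting probability takes the place of independence: each further
  miss multiplies the probability by \<open>1 - p\<close>, and the final hit contributes
  \<open>p\<close>.\<close>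

lemma prob_first_entrance:
  assumes X [measurable]: "\<And>n. X n \<in> borel_measurable M" and A [measurable]: "A \<in> sets borel"
    and cond: "\<And>k. AE \<omega> in M.
      real_cond_exp M (past M X k) (\<lambda>\<omega>. indicator A (X (Suc k) \<omega>)) \<omega> = p"
  shows "prob {\<omega> \<in> space M. first_entrance A X \<omega> = enat (Suc k)} = p * (1 - p) ^ k"
proof -
  define N where "N k = {\<omega> \<in> space M. \<forall>i\<in>{1..k}. X i \<omega> \<notin> A}" for k
  define H where "H k = {\<omega> \<in> space M. X k \<omega> \<in> A}" for k
  have [measurable]: "N k \<in> sets M" "H k \<in> sets M" for k
    unfolding N_def H_def by measurable
  have hit: "prob (N k \<inter> H (Suc k)) = p * prob (N k)" for k
  proof -
    interpret F: finite_measure_subalgebra M "past M X k"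
      by unfold_locales (rule subalgebra_past, rule X)
    have "N k = space M \<inter> (\<Inter>i\<in>{1..k}. space M - (X i -` A \<inter> space M))"
      by (auto simp: N_def)
    also have "\<dots> \<in> sets (past M X k)"
    \<comment> \<open>For \<open>k = 0\<close> the index set is empty, whereas the rule for finite
      intersections asks for a nonempty one.\<close>
    proof (cases "k = 0")
      case True
      then show ?thesis
        using sets.top[of "past M X k"] by simp
    next
      case False
      then show ?thesis
        using sets.top[of "past M X k"]
        by (intro sets.Int sets.finite_INT sets.Diff vimage_in_sets_past) auto
    qed
    finally have Nk: "N k \<in> sets (past M X k)" .
    have int: "integrable M (\<lambda>\<omega>. indicator A (X (Suc k) \<omega>) :: real)"
      by (rule integrable_const_bound[where B = 1]) (auto simp: indicator_def)
    have "prob (N k \<inter> H (Suc k)) = (\<integral>\<omega>. indicator (N k \<inter> H (Suc k)) \<omega> \<partial>M)"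
      by simp
    also have "\<dots> = (\<integral>\<omega>\<in>N k. indicator A (X (Suc k) \<omega>) \<partial>M)"
      unfolding set_lebesgue_integral_def
      by (intro Bochner_Integration.integral_cong) (auto simp: H_def N_def indicator_def)
    \<comment> \<open>The defining property of conditional expectation, available because
      \<open>N k\<close> is an event of the past.\<close>
    also have "\<dots> = (\<integral>\<omega>\<in>N k.
        real_cond_exp M (past M X k) (\<lambda>\<omega>. indicator A (X (Suc k) \<omega>)) \<omega> \<partial>M)"
      by (rule F.real_cond_exp_intA[OF int Nk])
    also have "\<dots> = (\<integral>\<omega>. p * indicator (N k) \<omega> \<partial>M)"
      unfolding set_lebesgue_integral_def
      using cond[of k] by (intro integral_cong_AE) (auto elim!: eventually_mono)
    also have "\<dots> = p * prob (N k)"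
      by simp
    finally show ?thesis .
  qed
  have N: "prob (N k) = (1 - p) ^ k" for k
  proof (induction k)
    case 0
    then show ?case by (simp add: N_def prob_space)
  next
    case (Suc k)
    have "N (Suc k) = N k - N k \<inter> H (Suc k)"
      by (auto simp: N_def H_def atLeastAtMostSuc_conv)
    then have "prob (N (Suc k)) = prob (N k) - prob (N k \<inter> H (Suc k))"
      by (simp add: finite_measure_Diff)
    then show ?case
      using Suc by (simp add: hit algebra_simps)
  qed
  have "{\<omega> \<in> space M. first_entrance A X \<omega> = enat (Suc k)} = N k \<inter> H (Suc k)"
    by (auto simp: first_entrance_eq_Suc_iff N_def H_def)
  then show ?thesis
    by (simp add: hit N)
qed

text \<open>The given masses sum to 1, so \<open>T\<close> is almost surely finite and the value of
  \<open>enat_power\<close> at \<infinity> has no influence, even for s > 1. What remains is a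
  geometric series of ratio s/2 < 1.\<close>

lemma nn_integral_enat_power_geometric:
  assumes T: "\<And>k. prob {\<omega> \<in> space M. T \<omega> = enat (Suc k)} = 1 / 2 ^ Suc k"
    and s: "0 \<le> s" "s < 2"
  shows "(\<integral>\<^sup>+\<omega>. enat_power s (T \<omega>) \<partial>M) = ennreal ((s / 2) / (1 - s / 2))"
proof -
  define E where "E k = {\<omega> \<in> space M. T \<omega> = enat (Suc k)}" for k
  \<comment> \<open>\<open>measure\<close> is 0 by default on non-measurable sets, so the positive
    mass in \<open>T\<close> yields measurability.\<close>
  have E [measurable]: "E k \<in> sets M" for k
    using T[of k] measure_notin_sets[of "E k" M] by (auto simp: E_def)
  have geom: "(\<lambda>k. c * (r ^ k)) sums (c / (1 - r))" if "0 \<le> r" "r < 1" for c r :: real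
    using sums_mult[OF geometric_sums[of r], of c] that by simp
  have disj: "disjoint_family E"
    by (auto simp: disjoint_family_on_def E_def)
  have "(\<lambda>k. prob (E k)) sums prob (\<Union>k. E k)"
    using disj by (intro finite_measure_UNION) auto
  moreover have "(\<lambda>k. prob (E k)) sums 1"
    using geom[of "1/2" "1/2"] T by (simp add: E_def power_divide)
  ultimately have "prob (\<Union>k. E k) = 1"
    by (rule sums_unique2)
  then have "AE \<omega> in M. \<omega> \<in> (\<Union>k. E k)"
    by (subst (asm) prob_eq_1) auto
  then have "(\<integral>\<^sup>+\<omega>. enat_power s (T \<omega>) \<partial>M)
      = (\<integral>\<^sup>+\<omega>. (\<Sum>k. ennreal (s ^ Suc k) * indicator (E k) \<omega>) \<partial>M)"
  proof (intro nn_integral_cong_AE, eventually_elim)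
    case (elim \<omega>)
    then obtain k where k: "\<omega> \<in> E k"
      by blast
    \<comment> \<open>By disjointness only the term with index \<open>k\<close> survives.\<close>
    have "(\<Sum>j. ennreal (s ^ Suc j) * indicator (E j) \<omega>) = ennreal (s ^ Suc k)"
      using disj k by (rule suminf_cmult_indicator)
    then show ?case
      using k by (simp add: E_def enat_power_def)
  qed
  also have "\<dots> = (\<Sum>k. ennreal (s ^ Suc k) * emeasure M (E k))"
    by (subst nn_integral_suminf) (auto simp: nn_integral_cmult)
  also have "\<dots> = (\<Sum>k. ennreal ((s / 2) * (s / 2) ^ k))"
    using T s by (intro suminf_cong)
      (simp add: emeasure_eq_measure E_def power_divide flip: ennreal_mult)
  also have "\<dots> = ennreal ((s / 2) / (1 - s / 2))"
    using s by (intro suminf_ennreal_eq geom) auto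
  finally show ?thesis .
qed

end

theorem lemma3p3:
  fixes \<alpha> :: real and \<nu> :: "real measure" and M :: "'a measure"
    and X :: "nat \<Rightarrow> 'a \<Rightarrow> real"
  assumes "\<alpha> > 0"
    and "symmetric_distribution \<nu>"
    and "measure \<nu> {0} = 0"
    and "kendall_random_walk M \<alpha> \<nu> X"
  shows "(\<forall>k\<ge>1. measure M {\<omega> \<in> space M. first_positive X \<omega> = enat k} = 1 / 2 ^ k)
    \<and> (\<forall>k\<ge>1. measure M {\<omega> \<in> space M. first_negative X \<omega> = enat k} = 1 / 2 ^ k)
    \<and> (\<forall>s. 0 \<le> s \<and> s < 2 \<longrightarrow>
        (\<integral>\<^sup>+\<omega>. enat_power s (first_positive X \<omega>) \<partial>M) = ennreal ((s / 2) / (1 - s / 2)))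
    \<and> (\<forall>s. 0 \<le> s \<and> s < 2 \<longrightarrow>
        (\<integral>\<^sup>+\<omega>. enat_power s (first_negative X \<omega>) \<partial>M) = ennreal ((s / 2) / (1 - s / 2)))"
proof -
  interpret kendall_random_walk M \<alpha> \<nu> X by fact
  have law: "prob {\<omega> \<in> space M. first_entrance A X \<omega> = enat (Suc k)} = 1 / 2 ^ Suc k"
    if A: "A \<in> {{0<..}, {..<0}}" for A k
  proof -
    have "measure (kendall_transition \<alpha> \<nu> 1 x) A = 1 / 2" for x
      using assms A by (intro measure_kendall_transition_half_line)
        (auto simp: symmetric_distribution_def)
    \<comment> \<open>The one-step transition mass is the same at every state, so the random state
      \<open>X k \<omega>\<close> drops out of the Markov property.\<close>
    then have "AE \<omega> in M.
        real_cond_exp M (past M X k) (\<lambda>\<omega>. indicator A (X (Suc k) \<omega>)) \<omega> = 1 / 2" for k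
      using markov_transition[of 1 A k] A by auto
    then show ?thesis
      using prob_first_entrance[of X A "1 / 2" k] random_variable_X A
      by (auto simp: power_divide)
  qed
  have pos: "first_positive X = first_entrance {0<..} X"
    and neg: "first_negative X = first_entrance {..<0} X"
    by (auto simp: first_positive_def first_negative_def first_entrance_def)
  have "prob {\<omega> \<in> space M. first_entrance A X \<omega> = enat k} = 1 / 2 ^ k"
    if "A \<in> {{0<..}, {..<0}}" "k \<ge> 1" for A k
    \<comment> \<open>Shifts the index, since \<open>law\<close> is stated for
      \<open>Suc k\<close>.\<close>
    using law[OF that(1), of "k - 1"] that(2) by simp
  then show ?thesis
    unfolding pos neg using nn_integral_enat_power_geometric[OF law] by auto
qed

end
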